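(* Let $v$ be a positive integer and, for $1\le i\le v$, let $(X_i,\kappa_i)$ and $(Y_i,\lambda_i)$ be (nonempty) digital images and $f_i: X_i\to Y_i$ a function. Let $X=\prod_{i=1}^v X_i$, $Y=\prod_{i=1}^v Y_i$, and let $f=\prod_{i=1}^v f_i: X\to Y$ be the product map $f(x_1,\dots,x_v)=(f_1(x_1),\dots,f_v(x_v))$. (1) For every integer $u$ with $1\le u\le v$: if $f: (X, NP_u(\kappa_1,\ldots,\kappa_v)) \to (Y, NP_u(\lambda_1,\ldots,\lambda_v))$ is an isomorphism, then $f_i:(X_i,\kappa_i)\to(Y_i,\lambda_i)$ is an isomorphism for every $1\le i\le v$. (2) If $f_i:(X_i,\kappa_i)\to(Y_i,\lambda_i)$ is an isomorphism for all $i$, then $f: (X, NP_v(\kappa_1,\ldots,\kappa_v)) \to (Y, NP_v(\lambda_1,\ldots,\lambda_v))$ is an isomorphism.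
   Context: A digital image $(X,\kappa)$ is a set $X$ (of lattice points in some $\mathbb{Z}^n$) with an adjacency relation $\kappa$, i.e. a symmetric irreflexive binary relation on $X$. A function $f:(X,\kappa)\to(Y,\lambda)$ is continuous if for all $\kappa$-adjacent $x,x'\in X$ the points $f(x),f(x')$ are equal or $\lambda$-adjacent (equivalently, $f$ maps connected sets to connected sets). An isomorphism of digital images is a continuous bijection whose inverse is continuous. $NP_u(\kappa_1,\dots,\kappa_v)$-adjacency on $\prod_{i=1}^v X_i$, for $1\le u\le v$: $(x_1,\dots,x_v)$ and $(x_1',\dots,x_v')$ are adjacent iff for at least $1$ and at most $u$ indices $i$, $x_i$ and $x_i'$ are $\kappa_i$-adjacent, and for all other indices $i$, $x_i=x_i'$. *)

theory Defs
  imports Main "HOL-Library.FuncSet"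
begin

text \<open>A point of the lattice of dimension \<open>n\<close> is the list of its \<open>n\<close> integer coordinates.\<close>

definition lattice_points :: "nat \<Rightarrow> int list set" where
  "lattice_points n = {p. length p = n}"

definition adjacency_on :: "'a set \<Rightarrow> ('a \<times> 'a) set \<Rightarrow> bool" where
  "adjacency_on X \<kappa> \<longleftrightarrow> \<kappa> \<subseteq> X \<times> X \<and> sym \<kappa> \<and> irrefl \<kappa>"

definition digital_image :: "int list set \<Rightarrow> (int list \<times> int list) set \<Rightarrow> bool" where
  "digital_image X \<kappa> \<longleftrightarrow> (\<exists>n. X \<subseteq> lattice_points n) \<and> adjacency_on X \<kappa>"

text \<open>Continuity and isomorphism are polymorphic in the type of points, because the points of
  a product image are tuples of lattice points.\<close>

definition digitally_continuous ::
    "'a set \<Rightarrow> ('a \<times> 'a) set \<Rightarrow> 'b set \<Rightarrow> ('b \<times> 'b) set \<Rightarrow> ('a \<Rightarrow> 'b) \<Rightarrow> bool" where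
  "digitally_continuous X \<kappa> Y \<mu> f \<longleftrightarrow>
     f \<in> X \<rightarrow> Y \<and>
     (\<forall>x\<in>X. \<forall>x'\<in>X. (x, x') \<in> \<kappa> \<longrightarrow> f x = f x' \<or> (f x, f x') \<in> \<mu>)"

definition digital_isomorphism ::
    "'a set \<Rightarrow> ('a \<times> 'a) set \<Rightarrow> 'b set \<Rightarrow> ('b \<times> 'b) set \<Rightarrow> ('a \<Rightarrow> 'b) \<Rightarrow> bool" where
  "digital_isomorphism X \<kappa> Y \<mu> f \<longleftrightarrow>
     bij_betw f X Y \<and>
     digitally_continuous X \<kappa> Y \<mu> f \<and>
     digitally_continuous Y \<mu> X \<kappa> (inv_into X f)"

text \<open>A tuple \<open>(x\<^sub>1, \<dots>, x\<^sub>v)\<close> is an extensional function on \<open>{1..v}\<close>; this is why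
  the product map restricts its value to \<open>{1..v}\<close>.\<close>

definition prod_image :: "nat \<Rightarrow> (nat \<Rightarrow> 'a set) \<Rightarrow> (nat \<Rightarrow> 'a) set" where
  "prod_image v X = (\<Pi>\<^sub>E i\<in>{1..v}. X i)"

definition prod_map :: "nat \<Rightarrow> (nat \<Rightarrow> 'a \<Rightarrow> 'b) \<Rightarrow> (nat \<Rightarrow> 'a) \<Rightarrow> (nat \<Rightarrow> 'b)" where
  "prod_map v f = (\<lambda>x. \<lambda>i\<in>{1..v}. f i (x i))"

definition NP_adj ::
    "nat \<Rightarrow> nat \<Rightarrow> (nat \<Rightarrow> 'a set) \<Rightarrow> (nat \<Rightarrow> ('a \<times> 'a) set) \<Rightarrow> ((nat \<Rightarrow> 'a) \<times> (nat \<Rightarrow> 'a)) set"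
  where
  "NP_adj u v X \<kappa> = {(x, x').
     x \<in> prod_image v X \<and> x' \<in> prod_image v X \<and>
     (let J = {i \<in> {1..v}. (x i, x' i) \<in> \<kappa> i}
      in 1 \<le> card J \<and> card J \<le> u \<and> (\<forall>i\<in>{1..v} - J. x i = x' i))}"

lemma adjacency_on_NP_adj:
  assumes "\<And>i. i \<in> {1..v} \<Longrightarrow> adjacency_on (X i) (\<kappa> i)"
  shows "adjacency_on (prod_image v X) (NP_adj u v X \<kappa>)"
proof -
  have sm: "sym (\<kappa> i)" and irr: "irrefl (\<kappa> i)" if "i \<in> {1..v}" for i
    using assms[OF that] by (simp_all add: adjacency_on_def)
  define J where "J = (\<lambda>x x'. {i \<in> {1..v}. (x i, x' i) \<in> \<kappa> i})"
  have NP: "(x, x') \<in> NP_adj u v X \<kappa> \<longleftrightarrow> x \<in> prod_image v X \<and> x' \<in> prod_image v X \<and>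
      1 \<le> card (J x x') \<and> card (J x x') \<le> u \<and> (\<forall>i\<in>{1..v} - J x x'. x i = x' i)" for x x'
    unfolding NP_adj_def J_def Let_def by (rule iffI; blast)
  have Jsub: "J x x' \<subseteq> J x' x" for x x'
    unfolding J_def using sm[THEN symD] by fast
  then have J: "J x x' = J x' x" for x x'
    by (intro equalityI)
  have J0: "J x x = {}" for x
    unfolding J_def using irr[THEN irreflD] by fast
  have "sym (NP_adj u v X \<kappa>)"
  proof (rule symI)
    fix x x' assume "(x, x') \<in> NP_adj u v X \<kappa>"
    then show "(x', x) \<in> NP_adj u v X \<kappa>"
      unfolding NP J[of x' x] by metis
  qed
  moreover have "irrefl (NP_adj u v X \<kappa>)"
    by (rule irreflI) (simp add: NP J0)
  moreover have "NP_adj u v X \<kappa> \<subseteq> prod_image v X \<times> prod_image v X"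
    using NP by fast
  ultimately show ?thesis
    by (simp add: adjacency_on_def)
qed

end

(* An isomorphism is the same as a bijection that preserves and reflects adjacency. Such a condition
   passes to products coordinatewise, since the set of coordinates in which two points are adjacent
   does not change under the product map. Conversely, fixing all coordinates but the i-th embeds
   the i-th factor into the product as an induced subimage for every u \<ge> 1, and the product map
   restricts to f i on this copy. *)

theory Submission
  imports Defs
begin

text \<open>Continuity alone lets a map merge adjacent points. A bijection cannot do this, because
  irreflexivity makes adjacent points distinct; so continuity of \<open>f\<close> amounts to
  preservation of adjacency, and continuity of the inverse to reflection.\<close>

lemma digital_isomorphism_iff:
  assumes "adjacency_on X \<kappa>" "adjacency_on Y \<mu>"
  shows "digital_isomorphism X \<kappa> Y \<mu> f \<longleftrightarrow>
    bij_betw f X Y \<and> (\<forall>x\<in>X. \<forall>x'\<in>X. (x, x') \<in> \<kappa> \<longleftrightarrow> (f x, f x') \<in> \<mu>)"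
proof (cases "bij_betw f X Y")
  case True
  then have inj: "inj_on f X" and Y: "Y = f ` X"
    by (simp_all add: bij_betw_def)
  have irr: "(x, x) \<notin> \<kappa>" "(y, y) \<notin> \<mu>" for x y
    using assms by (auto simp: adjacency_on_def irrefl_def)
  \<comment> \<open>The two implications assumed here are the continuity of \<open>f\<close> and
    that of its inverse, the latter read at the image points \<open>f x\<close> and
    \<open>f x'\<close>.\<close>
  have "(x, x') \<in> \<kappa> \<longleftrightarrow> (f x, f x') \<in> \<mu>"
    if "(x, x') \<in> \<kappa> \<longrightarrow> f x = f x' \<or> (f x, f x') \<in> \<mu>"
      "(f x, f x') \<in> \<mu> \<longrightarrow> x = x' \<or> (x, x') \<in> \<kappa>" "x \<in> X" "x' \<in> X" for x x'
    using that irr inj_on_eq_iff[OF inj, of x x'] by auto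
  \<comment> \<open>Writing \<open>Y\<close> as the image of \<open>X\<close> turns quantifiers over
    \<open>Y\<close> into quantifiers over \<open>X\<close>, where \<open>inv_into X f\<close>
    cancels against \<open>f\<close>.\<close>
  then show ?thesis
    using inj unfolding digital_isomorphism_def digitally_continuous_def Y
    by (simp add: True[unfolded Y] Pi_iff) blast
next
  case False
  then show ?thesis
    by (simp add: digital_isomorphism_def)
qed

lemma prod_map_apply: "i \<in> {1..v} \<Longrightarrow> prod_map v f x i = f i (x i)"
  by (simp add: prod_map_def)

lemma prod_map_in_prod_image:
  assumes "\<And>i. i \<in> {1..v} \<Longrightarrow> f i \<in> X i \<rightarrow> Y i" "x \<in> prod_image v X"
  shows "prod_map v f x \<in> prod_image v Y"
  using assms unfolding prod_map_def prod_image_def by fastforce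

lemma prod_image_fun_upd:
  "z \<in> prod_image v X \<Longrightarrow> i \<in> {1..v} \<Longrightarrow> a \<in> X i \<Longrightarrow> z(i := a) \<in> prod_image v X"
  unfolding prod_image_def by (auto simp: PiE_iff extensional_def)

text \<open>This is how the product map restricts to \<open>f i\<close>: the copy of the i-th factor
  through \<open>z\<close> goes to the copy through \<open>prod_map v f z\<close>.\<close>

lemma prod_map_fun_upd:
  "i \<in> {1..v} \<Longrightarrow> prod_map v f (z(i := a)) = (prod_map v f z)(i := f i a)"
  by (auto simp: prod_map_def fun_eq_iff)

lemma prod_image_eqI:
  "x \<in> prod_image v X \<Longrightarrow> x' \<in> prod_image v X \<Longrightarrow> (\<And>i. i \<in> {1..v} \<Longrightarrow> x i = x' i) \<Longrightarrow> x = x'"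
  unfolding prod_image_def by (rule PiE_ext)

lemma NP_adj_iff:
  "(x, x') \<in> NP_adj u v X \<kappa> \<longleftrightarrow> x \<in> prod_image v X \<and> x' \<in> prod_image v X \<and>
     1 \<le> card {i \<in> {1..v}. (x i, x' i) \<in> \<kappa> i} \<and> card {i \<in> {1..v}. (x i, x' i) \<in> \<kappa> i} \<le> u \<and>
     (\<forall>i\<in>{1..v}. (x i, x' i) \<notin> \<kappa> i \<longrightarrow> x i = x' i)"
  unfolding NP_adj_def Let_def by (rule iffI; blast)

text \<open>By irreflexivity the two points can be adjacent in coordinate \<open>i\<close> only, so
  the index set is a singleton or empty. The lower bound in \<open>NP_adj\<close> rejects the empty
  set, and 1 \<le> \<open>u\<close> admits the singleton.\<close>

lemma NP_adj_fun_upd: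
  assumes "\<And>j. j \<in> {1..v} \<Longrightarrow> adjacency_on (X j) (\<kappa> j)"
    and z: "z \<in> prod_image v X" and i: "i \<in> {1..v}" and "a \<in> X i" "b \<in> X i" "1 \<le> u"
  shows "(z(i := a), z(i := b)) \<in> NP_adj u v X \<kappa> \<longleftrightarrow> (a, b) \<in> \<kappa> i"
proof -
  have irr: "(c, c) \<notin> \<kappa> j" if "j \<in> {1..v}" for c j
    using assms(1)[OF that] by (auto simp: adjacency_on_def irrefl_def)
  have "{j \<in> {1..v}. ((z(i := a)) j, (z(i := b)) j) \<in> \<kappa> j} = (if (a, b) \<in> \<kappa> i then {i} else {})"
    using i irr by (auto split: if_splits)
  then show ?thesis
    using assms prod_image_fun_upd[OF z i] unfolding NP_adj_iff by auto
qed

lemma bij_betw_prod_map: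
  assumes "\<And>i. i \<in> {1..v} \<Longrightarrow> bij_betw (f i) (X i) (Y i)"
  shows "bij_betw (prod_map v f) (prod_image v X) (prod_image v Y)"
proof (rule bij_betwI')
  fix x x' assume x: "x \<in> prod_image v X" "x' \<in> prod_image v X"
  show "prod_map v f x = prod_map v f x' \<longleftrightarrow> x = x'"
  proof
    assume eq: "prod_map v f x = prod_map v f x'"
    show "x = x'"
    proof (rule prod_image_eqI[OF x])
      fix i assume i: "i \<in> {1..v}"
      have "f i (x i) = f i (x' i)"
        using fun_cong[OF eq, of i] i by (simp add: prod_map_apply)
      moreover have "x i \<in> X i" "x' i \<in> X i"
        using x i by (auto simp: prod_image_def)
      ultimately show "x i = x' i"
        using assms[OF i] by (auto simp: bij_betw_def dest: inj_onD)
    qed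
  qed simp
next
  fix x assume "x \<in> prod_image v X"
  then show "prod_map v f x \<in> prod_image v Y"
    using assms by (intro prod_map_in_prod_image) (auto simp: bij_betw_def)
next
  fix y assume y: "y \<in> prod_image v Y"
  \<comment> \<open>The preimage is found by inverting each factor separately.\<close>
  define x where "x = prod_map v (\<lambda>i. inv_into (X i) (f i)) y"
  have "x \<in> prod_image v X"
    unfolding x_def using assms y
    by (intro prod_map_in_prod_image) (auto simp: bij_betw_def inv_into_into)
  moreover have "y = prod_map v f x"
  proof (rule prod_image_eqI[OF y])
    show "prod_map v f x \<in> prod_image v Y"
      using assms \<open>x \<in> prod_image v X\<close>
      by (intro prod_map_in_prod_image) (auto simp: bij_betw_def)
    fix i assume i: "i \<in> {1..v}"
    then have "y i \<in> Y i"
      using y by (auto simp: prod_image_def)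
    then show "y i = prod_map v f x i"
      using bij_betw_inv_into_right[OF assms[OF i]] i by (simp add: x_def prod_map_apply)
  qed
  ultimately show "\<exists>x\<in>prod_image v X. y = prod_map v f x"
    by blast
qed

text \<open>The base point \<open>z\<close> fills the other coordinates, so that points of a single
  factor can be tested in the product. Injectivity compares two updates of \<open>z\<close> at
  \<open>i\<close>; surjectivity projects a preimage to coordinate \<open>i\<close>.\<close>

lemma bij_betw_factor:
  assumes bij: "bij_betw (prod_map v f) (prod_image v X) (prod_image v Y)"
    and f: "\<And>i. i \<in> {1..v} \<Longrightarrow> f i \<in> X i \<rightarrow> Y i"
    and z: "z \<in> prod_image v X" and i: "i \<in> {1..v}"
  shows "bij_betw (f i) (X i) (Y i)"
proof (rule bij_betwI')
  fix a b assume ab: "a \<in> X i" "b \<in> X i"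
  show "f i a = f i b \<longleftrightarrow> a = b"
  proof
    assume "f i a = f i b"
    then have "prod_map v f (z(i := a)) = prod_map v f (z(i := b))"
      by (simp only: prod_map_fun_upd[OF i])
    then have "z(i := a) = z(i := b)"
      using bij prod_image_fun_upd[OF z i] ab by (auto simp: bij_betw_def dest: inj_onD)
    then show "a = b"
      by (metis fun_upd_same)
  qed simp
next
  fix a assume "a \<in> X i"
  then show "f i a \<in> Y i"
    using f[OF i] by auto
next
  fix y assume "y \<in> Y i"
  \<comment> \<open>The coordinates other than \<open>i\<close> serve only to extend
    \<open>y\<close> to a point of the product.\<close>
  then have "(prod_map v f z)(i := y) \<in> prod_image v Y"
    using prod_map_in_prod_image[OF f z] i by (intro prod_image_fun_upd)
  then obtain x where x: "x \<in> prod_image v X" "(prod_map v f z)(i := y) = prod_map v f x"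
    using bij by (auto simp: bij_betw_def)
  have "y = f i (x i)"
    using fun_cong[OF x(2), of i] i by (simp add: prod_map_apply)
  moreover have "x i \<in> X i"
    using x(1) i by (auto simp: prod_image_def)
  ultimately show "\<exists>a\<in>X i. y = f i a"
    by blast
qed

lemma digital_isomorphism_factor:
  assumes iso: "digital_isomorphism (prod_image v X) (NP_adj u v X \<kappa>)
      (prod_image v Y) (NP_adj u v Y \<mu>) (prod_map v f)"
    and X: "\<And>i. i \<in> {1..v} \<Longrightarrow> adjacency_on (X i) (\<kappa> i)"
    and Y: "\<And>i. i \<in> {1..v} \<Longrightarrow> adjacency_on (Y i) (\<mu> i)"
    and ne: "\<And>i. i \<in> {1..v} \<Longrightarrow> X i \<noteq> {}"
    and f: "\<And>i. i \<in> {1..v} \<Longrightarrow> f i \<in> X i \<rightarrow> Y i"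
    and u: "1 \<le> u" and i: "i \<in> {1..v}"
  shows "digital_isomorphism (X i) (\<kappa> i) (Y i) (\<mu> i) (f i)"
proof -
  \<comment> \<open>Nonempty factors supply the base point through which the i-th factor is
    embedded.\<close>
  have "prod_image v X \<noteq> {}"
    using ne by (simp add: prod_image_def PiE_eq_empty_iff)
  then obtain z where z: "z \<in> prod_image v X"
    by blast
  have bij: "bij_betw (prod_map v f) (prod_image v X) (prod_image v Y)"
    and adj: "(x, x') \<in> NP_adj u v X \<kappa> \<longleftrightarrow> (prod_map v f x, prod_map v f x') \<in> NP_adj u v Y \<mu>"
    if "x \<in> prod_image v X" "x' \<in> prod_image v X" for x x'
    using iso that digital_isomorphism_iff[OF adjacency_on_NP_adj[of v X \<kappa> u, OF X] adjacency_on_NP_adj[of v Y \<mu> u, OF Y]]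
    by blast+
  have "(a, b) \<in> \<kappa> i \<longleftrightarrow> (f i a, f i b) \<in> \<mu> i" if ab: "a \<in> X i" "b \<in> X i" for a b
  proof -
    have "(a, b) \<in> \<kappa> i \<longleftrightarrow> (z(i := a), z(i := b)) \<in> NP_adj u v X \<kappa>"
      using NP_adj_fun_upd[OF X z i ab u] by blast
    \<comment> \<open>The isomorphism is applied within the copy through \<open>z\<close>; the image
      pair lies in the copy through \<open>prod_map v f z\<close>, where the embedding is undone
      next.\<close>
    also have "\<dots> \<longleftrightarrow> ((prod_map v f z)(i := f i a), (prod_map v f z)(i := f i b)) \<in> NP_adj u v Y \<mu>"
      using adj prod_image_fun_upd[OF z i] ab by (simp only: prod_map_fun_upd[OF i])
    also have "\<dots> \<longleftrightarrow> (f i a, f i b) \<in> \<mu> i"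
      using ab f[OF i] by (intro NP_adj_fun_upd[OF Y prod_map_in_prod_image[OF f z] i _ _ u]) auto
    finally show ?thesis .
  qed
  then show ?thesis
    using bij_betw_factor[OF bij[OF z z] f z i] digital_isomorphism_iff[OF X[OF i] Y[OF i]] by blast
qed

text \<open>Coordinatewise bijections that preserve and reflect adjacency keep both the set of
  adjacent coordinates and the equalities elsewhere. The cardinality bounds therefore carry over for
  the same \<open>u\<close>.\<close>

lemma digital_isomorphism_prod_map:
  assumes iso: "\<And>i. i \<in> {1..v} \<Longrightarrow> digital_isomorphism (X i) (\<kappa> i) (Y i) (\<mu> i) (f i)"
    and X: "\<And>i. i \<in> {1..v} \<Longrightarrow> adjacency_on (X i) (\<kappa> i)"
    and Y: "\<And>i. i \<in> {1..v} \<Longrightarrow> adjacency_on (Y i) (\<mu> i)"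
  shows "digital_isomorphism (prod_image v X) (NP_adj u v X \<kappa>)
    (prod_image v Y) (NP_adj u v Y \<mu>) (prod_map v f)"
proof -
  have bij: "bij_betw (f i) (X i) (Y i)"
    and adj: "\<forall>a\<in>X i. \<forall>b\<in>X i. (a, b) \<in> \<kappa> i \<longleftrightarrow> (f i a, f i b) \<in> \<mu> i"
    if "i \<in> {1..v}" for i
    using iso[OF that] digital_isomorphism_iff[OF X[OF that] Y[OF that]] by blast+
  have "(x, x') \<in> NP_adj u v X \<kappa> \<longleftrightarrow> (prod_map v f x, prod_map v f x') \<in> NP_adj u v Y \<mu>"
    if x: "x \<in> prod_image v X" "x' \<in> prod_image v X" for x x'
  proof -
    have mem: "x i \<in> X i" "x' i \<in> X i" if "i \<in> {1..v}" for i
      using x that by (auto simp: prod_image_def)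
    \<comment> \<open>\<open>J\<close> comes from the adjacency criterion for \<open>f i\<close>,
      and \<open>E\<close> from its injectivity.\<close>
    have J: "(prod_map v f x i, prod_map v f x' i) \<in> \<mu> i \<longleftrightarrow> (x i, x' i) \<in> \<kappa> i"
      and E: "prod_map v f x i = prod_map v f x' i \<longleftrightarrow> x i = x' i" if "i \<in> {1..v}" for i
      using adj[OF that] bij[OF that] mem[OF that]
      by (auto simp: prod_map_apply[OF that] bij_betw_def dest: inj_onD)
    have "{i \<in> {1..v}. (prod_map v f x i, prod_map v f x' i) \<in> \<mu> i} =
        {i \<in> {1..v}. (x i, x' i) \<in> \<kappa> i}"
      using J by blast
    moreover have "prod_map v f x \<in> prod_image v Y" "prod_map v f x' \<in> prod_image v Y"
      using bij_betw_prod_map[of v f X Y, OF bij] x by (blast dest: bij_betwE)+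
    ultimately show ?thesis
      using x J E unfolding NP_adj_iff by simp
  qed
  then show ?thesis
    using bij_betw_prod_map[of v f X Y, OF bij]
      digital_isomorphism_iff[OF adjacency_on_NP_adj[of v X \<kappa> u, OF X] adjacency_on_NP_adj[of v Y \<mu> u, OF Y]] by blast
qed

theorem theorem4p5:
  fixes v :: nat
    and X Y :: "nat \<Rightarrow> int list set"
    and \<kappa> \<mu> :: "nat \<Rightarrow> (int list \<times> int list) set"
    and f :: "nat \<Rightarrow> int list \<Rightarrow> int list"
  assumes "1 \<le> v"
    and "\<And>i. i \<in> {1..v} \<Longrightarrow> digital_image (X i) (\<kappa> i) \<and> X i \<noteq> {}"
    and "\<And>i. i \<in> {1..v} \<Longrightarrow> digital_image (Y i) (\<mu> i) \<and> Y i \<noteq> {}"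
    and "\<And>i. i \<in> {1..v} \<Longrightarrow> f i \<in> X i \<rightarrow> Y i"
  shows "(\<forall>u\<in>{1..v}.
            digital_isomorphism (prod_image v X) (NP_adj u v X \<kappa>)
              (prod_image v Y) (NP_adj u v Y \<mu>) (prod_map v f)
            \<longrightarrow> (\<forall>i\<in>{1..v}. digital_isomorphism (X i) (\<kappa> i) (Y i) (\<mu> i) (f i)))
       \<and> ((\<forall>i\<in>{1..v}. digital_isomorphism (X i) (\<kappa> i) (Y i) (\<mu> i) (f i))
            \<longrightarrow> digital_isomorphism (prod_image v X) (NP_adj v v X \<kappa>)
                  (prod_image v Y) (NP_adj v v Y \<mu>) (prod_map v f))"
proof -
  have X: "adjacency_on (X i) (\<kappa> i)" "X i \<noteq> {}" and Y: "adjacency_on (Y i) (\<mu> i)"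
    if "i \<in> {1..v}" for i
    using assms(2,3)[OF that] by (simp_all add: digital_image_def)
  show ?thesis
    \<comment> \<open>The first wildcard leaves \<open>u\<close> open, as part (1) ranges over all
      \<open>u\<close>; part (2) is the instance of the second lemma with \<open>u\<close> equal to
      \<open>v\<close>.\<close>
    using digital_isomorphism_factor[of v X _ \<kappa> Y \<mu> f, OF _ X(1) Y X(2) assms(4)]
      digital_isomorphism_prod_map[of v X \<kappa> Y \<mu> f v, OF _ X(1) Y]
    by auto
qed

end
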